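(* Let $\beta\in(1,2)$ and $\alpha\in\mathbb{Q}(\beta)\cap(0,2-\beta)$. For each choice of sign $\pm$ the following hold. (i) If $\mathbb{Q}\cap J_{\beta,\alpha}\subseteq \operatorname{Preper}^{\pm}(\beta,\alpha)$, then $\beta$ is either a Pisot number or a Salem number. (ii) If $\beta$ is a Pisot number, then $\operatorname{Preper}^{\pm}(\beta,\alpha)=\mathbb{Q}(\beta)\cap J_{\beta,\alpha}$.
   Context: For $\beta\in(1,2)$ and $\alpha\in[0,2-\beta]$ put $p=(1-\alpha)/\beta$ and $J_{\beta,\alpha}=[-\alpha/(\beta-1),(1-\alpha)/(\beta-1)]$. The maps $T^{\pm}_{\beta,\alpha}:J_{\beta,\alpha}\to J_{\beta,\alpha}$ are: $T^+_{\beta,\alpha}(x)=\beta x+\alpha$ if $x<p$ and $\beta x+\alpha-1$ otherwise; $T^-_{\beta,\alpha}(x)=\beta x+\alpha$ if $x\le p$ and $\beta x+\alpha-1$ otherwise. $\operatorname{Preper}^{\pm}(\beta,\alpha)$ denotes the set of $x\in J_{\beta,\alpha}$ that are eventually periodic under $T^{\pm}_{\beta,\alpha}$, i.e. for which $\{(T^{\pm}_{\beta,\alpha})^n(x):n\in\mathbb{N}\}$ is finite. A Pisot number is a real algebraic integer greater than $1$ all of whose other Galois conjugates have modulus strictly less than $1$. A Salem number is a real algebraic integer greater than $1$ all of whose other Galois conjugates have modulus at most $1$, with at least one of modulus exactly $1$. *)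

theory Defs
  imports
    "HOL-Analysis.Analysis"
    "HOL-Computational_Algebra.Computational_Algebra"
    "HOL-Algebra.Generated_Fields"
begin

definition real_field :: "real ring"
  where "real_field = \<lparr>carrier = UNIV, mult = (*), one = 1, zero = 0, add = (+)\<rparr>"

(* The subfield of the reals generated by \<beta>; the rationals need not be listed
   among the generators, since they form the prime field. *)
definition rat_adjoin :: "real \<Rightarrow> real set"
  where "rat_adjoin \<beta> = generate_field real_field {\<beta>}"

definition is_minimal_polynomial :: "rat poly \<Rightarrow> 'a :: field_char_0 \<Rightarrow> bool"
  where "is_minimal_polynomial f x \<longleftrightarrow>
    lead_coeff f = 1 \<and> irreducible f \<and> poly (map_poly of_rat f) x = 0"

(* x counts as a conjugate of itself. *)
definition galois_conjugate :: "real \<Rightarrow> complex \<Rightarrow> bool"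
  where "galois_conjugate x z \<longleftrightarrow>
    (\<exists>f. is_minimal_polynomial f x \<and> poly (map_poly of_rat f) z = 0)"

definition pisot_number :: "real \<Rightarrow> bool"
  where "pisot_number x \<longleftrightarrow> algebraic_int x \<and> x > 1 \<and>
    (\<forall>z. galois_conjugate x z \<and> z \<noteq> complex_of_real x \<longrightarrow> norm z < 1)"

definition salem_number :: "real \<Rightarrow> bool"
  where "salem_number x \<longleftrightarrow> algebraic_int x \<and> x > 1 \<and>
    (\<forall>z. galois_conjugate x z \<and> z \<noteq> complex_of_real x \<longrightarrow> norm z \<le> 1) \<and>
    (\<exists>z. galois_conjugate x z \<and> z \<noteq> complex_of_real x \<and> norm z = 1)"

definition J_int :: "real \<Rightarrow> real \<Rightarrow> real set"
  where "J_int \<beta> \<alpha> = {- \<alpha> / (\<beta> - 1) .. (1 - \<alpha>) / (\<beta> - 1)}"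

definition crit :: "real \<Rightarrow> real \<Rightarrow> real"
  where "crit \<beta> \<alpha> = (1 - \<alpha>) / \<beta>"

datatype sign = Plus | Minus

(* Plus and Minus differ only in the branch taken at the discontinuity crit.
   The maps are total on the reals; they restrict to self-maps of J_int by T_map_in_J below. *)
fun T_map :: "sign \<Rightarrow> real \<Rightarrow> real \<Rightarrow> real \<Rightarrow> real" where
  "T_map Plus \<beta> \<alpha> x = (if x < crit \<beta> \<alpha> then \<beta> * x + \<alpha> else \<beta> * x + \<alpha> - 1)"
| "T_map Minus \<beta> \<alpha> x = (if x \<le> crit \<beta> \<alpha> then \<beta> * x + \<alpha> else \<beta> * x + \<alpha> - 1)"

definition Preper :: "sign \<Rightarrow> real \<Rightarrow> real \<Rightarrow> real set"
  where "Preper s \<beta> \<alpha> = {x \<in> J_int \<beta> \<alpha>. finite (range (\<lambda>n. (T_map s \<beta> \<alpha> ^^ n) x))}"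

lemma T_map_in_J:
  assumes "1 < \<beta>" "\<beta> < 2" "0 \<le> \<alpha>" "\<alpha> \<le> 2 - \<beta>" "x \<in> J_int \<beta> \<alpha>"
  shows "T_map s \<beta> \<alpha> x \<in> J_int \<beta> \<alpha>"
proof -
  have b: "\<beta> - 1 > 0" "\<beta> > 0" using assms by auto
  have lo: "- \<alpha> \<le> x * (\<beta> - 1)" and hi: "x * (\<beta> - 1) \<le> 1 - \<alpha>"
    using assms(5) b by (auto simp: J_int_def field_simps)
  have J_iff: "y \<in> J_int \<beta> \<alpha> \<longleftrightarrow> - \<alpha> \<le> y * (\<beta> - 1) \<and> y * (\<beta> - 1) \<le> 1 - \<alpha>" for y
    using b by (auto simp: J_int_def field_simps)
  have left: "\<beta> * x + \<alpha> \<in> J_int \<beta> \<alpha>" if "\<beta> * x \<le> 1 - \<alpha>"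
  proof -
    have "\<beta> * (x * (\<beta> - 1)) \<ge> \<beta> * (- \<alpha>)" using lo b by (intro mult_left_mono) auto
    moreover have "(\<beta> * x + \<alpha>) * (\<beta> - 1) \<le> 1 * (\<beta> - 1)"
      using that b by (intro mult_right_mono) auto
    ultimately show ?thesis using assms by (simp add: J_iff algebra_simps)
  qed
  have right: "\<beta> * x + \<alpha> - 1 \<in> J_int \<beta> \<alpha>" if "\<beta> * x \<ge> 1 - \<alpha>"
  proof -
    have "\<beta> * (x * (\<beta> - 1)) \<le> \<beta> * (1 - \<alpha>)" using hi b by (intro mult_left_mono) auto
    moreover have "(\<beta> * x + \<alpha> - 1) * (\<beta> - 1) \<ge> 0 * (\<beta> - 1)"
      using that b by (intro mult_right_mono) auto
    ultimately show ?thesis using assms by (simp add: J_iff algebra_simps)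
  qed
  have "x \<le> crit \<beta> \<alpha> \<longleftrightarrow> \<beta> * x \<le> 1 - \<alpha>" "x < crit \<beta> \<alpha> \<longleftrightarrow> \<beta> * x < 1 - \<alpha>"
    using b by (auto simp: crit_def pos_le_divide_eq pos_less_divide_eq mult.commute)
  then show ?thesis using left right by (cases s) auto
qed

lemma field_real_field: "field real_field"
proof -
  have "\<exists>y. x + y = 0" for x :: real by (rule exI[of _ "- x"]) simp
  then have "cring real_field"
    by (intro cringI abelian_groupI comm_monoidI) (auto simp: real_field_def algebra_simps)
  moreover have "\<exists>y. x * y = 1" if "x \<noteq> 0" for x :: real
    using that by (intro exI[of _ "inverse x"]) simp
  ultimately show ?thesis
    by (intro cring.cring_fieldI2) (auto simp: real_field_def)
qed

lemma real_field_ops [simp]: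
  shows "carrier real_field = UNIV"
    and "\<one>\<^bsub>real_field\<^esub> = 1" "\<zero>\<^bsub>real_field\<^esub> = 0"
    and "x \<oplus>\<^bsub>real_field\<^esub> y = x + y" "x \<otimes>\<^bsub>real_field\<^esub> y = x * y"
    and "\<ominus>\<^bsub>real_field\<^esub> x = - x"
    and "x \<noteq> 0 \<Longrightarrow> inv\<^bsub>real_field\<^esub> x = inverse x"
proof -
  interpret R: field real_field by (rule field_real_field)
  show ops: "carrier real_field = UNIV"
    "\<one>\<^bsub>real_field\<^esub> = 1" "\<zero>\<^bsub>real_field\<^esub> = 0"
    "x \<oplus>\<^bsub>real_field\<^esub> y = x + y" "x \<otimes>\<^bsub>real_field\<^esub> y = x * y" for x y
    by (auto simp: real_field_def)
  show "\<ominus>\<^bsub>real_field\<^esub> x = - x"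
    using R.minus_equality[of "- x" x] by (simp add: ops)
  show "inv\<^bsub>real_field\<^esub> x = inverse x" if "x \<noteq> 0"
    using that R.comm_inv_char[of x "inverse x"] by (simp add: ops)
qed

lemma rat_adjoin_closed:
  shows "\<beta> \<in> rat_adjoin \<beta>" "1 \<in> rat_adjoin \<beta>" "0 \<in> rat_adjoin \<beta>"
    and "x \<in> rat_adjoin \<beta> \<Longrightarrow> - x \<in> rat_adjoin \<beta>"
    and "x \<in> rat_adjoin \<beta> \<Longrightarrow> inverse x \<in> rat_adjoin \<beta>"
    and "x \<in> rat_adjoin \<beta> \<Longrightarrow> y \<in> rat_adjoin \<beta> \<Longrightarrow> x + y \<in> rat_adjoin \<beta>"
    and "x \<in> rat_adjoin \<beta> \<Longrightarrow> y \<in> rat_adjoin \<beta> \<Longrightarrow> x * y \<in> rat_adjoin \<beta>"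
proof -
  have zero: "0 \<in> rat_adjoin \<beta>"
    using field.zero_in_generate[OF field_real_field] by (simp add: rat_adjoin_def)
  then show "0 \<in> rat_adjoin \<beta>" .
  show "\<beta> \<in> rat_adjoin \<beta>" "1 \<in> rat_adjoin \<beta>"
    using generate_field.one[of real_field "{\<beta>}"] generate_field.incl[of \<beta> "{\<beta>}" real_field]
    by (simp_all add: rat_adjoin_def)
  show "- x \<in> rat_adjoin \<beta>" if "x \<in> rat_adjoin \<beta>"
    using generate_field.a_inv[of x real_field "{\<beta>}"] that by (simp add: rat_adjoin_def)
  show "inverse x \<in> rat_adjoin \<beta>" if "x \<in> rat_adjoin \<beta>"
    using generate_field.m_inv[of x real_field "{\<beta>}"] that zero
    by (cases "x = 0") (simp_all add: rat_adjoin_def)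
  show "x + y \<in> rat_adjoin \<beta>" "x * y \<in> rat_adjoin \<beta>"
    if "x \<in> rat_adjoin \<beta>" "y \<in> rat_adjoin \<beta>"
    using generate_field.eng_add[of x real_field "{\<beta>}" y]
      generate_field.eng_mult[of x real_field "{\<beta>}" y] that
    by (simp_all add: rat_adjoin_def)
qed

lemma rat_adjoin_minimal:
  assumes "\<beta> \<in> K" "1 \<in> K"
    and "\<And>x. x \<in> K \<Longrightarrow> - x \<in> K" "\<And>x. x \<in> K \<Longrightarrow> inverse x \<in> K"
    and "\<And>x y. x \<in> K \<Longrightarrow> y \<in> K \<Longrightarrow> x + y \<in> K" "\<And>x y. x \<in> K \<Longrightarrow> y \<in> K \<Longrightarrow> x * y \<in> K"
  shows "rat_adjoin \<beta> \<subseteq> K"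
proof
  fix x assume "x \<in> rat_adjoin \<beta>"
  then have "x \<in> generate_field real_field {\<beta>}" by (simp add: rat_adjoin_def)
  then show "x \<in> K"
    by (induction rule: generate_field.induct) (use assms in auto)
qed

end

theory Submission
  imports Defs "HOL-Computational_Algebra.Field_as_Ring"
begin

text \<open>
  Write \<open>d k\<close> for the digits of \<open>x\<close>, so that the orbit satisfies \<open>T x = \<beta> x + \<alpha> - d 0\<close>.

  (i) If \<open>x\<close> and \<open>y\<close> have a common preperiod and period, then subtracting their expansions
  eliminates \<open>\<alpha>\<close> and gives \<open>(\<beta>^m - \<beta>^n) (x - y) = P \<beta>\<close> with \<open>P\<close> integral of degree less than \<open>m\<close>.
  For \<open>x - y = 1\<close> this shows that \<open>\<beta>\<close> is an algebraic integer. For rational \<open>x\<close>, \<open>y\<close> the relation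
  passes to a conjugate \<open>\<gamma>\<close>; if \<open>norm \<gamma> > 1\<close>, it says that \<open>\<Phi> x = (\<Sum>k. d k / \<gamma>^(k+1))\<close> satisfies
  \<open>\<Phi> x - \<Phi> y = x - y\<close>. By one-sided continuity \<open>\<Phi> x - x\<close> is then constant on all of \<open>[0,1)\<close>, and
  comparing \<open>\<Phi> (T x) = \<gamma> \<Phi> x - d 0\<close> with \<open>T x = \<beta> x + \<alpha> - d 0\<close> at two points with first digit
  \<open>0\<close> forces \<open>\<gamma> = \<beta>\<close>.

  (ii) For a Pisot number, clearing denominators represents the orbit of a point of the number field
  by integer polynomials in \<open>\<beta>\<close> of degree below that of the minimal polynomial. Their values at every
  conjugate of \<open>\<beta>\<close> stay bounded, so by Lagrange interpolation so do their coefficients.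
\<close>

hide_const (open) Module.smult UnivPoly.coeff UnivPoly.monom

section \<open>Evaluation of rational polynomials in fields of characteristic zero\<close>

abbreviation rpoly :: "rat poly \<Rightarrow> 'a :: field_char_0 \<Rightarrow> 'a"
  where "rpoly p z \<equiv> poly (map_poly of_rat p) z"

lemma map_poly_of_rat_add:
  "map_poly of_rat (p + q) = (map_poly of_rat p + map_poly of_rat q :: 'a :: field_char_0 poly)"
  by (rule poly_eqI) (simp add: coeff_map_poly of_rat_add)

lemma map_poly_of_rat_minus:
  "map_poly of_rat (- p) = (- map_poly of_rat p :: 'a :: field_char_0 poly)"
  by (rule poly_eqI) (simp add: coeff_map_poly of_rat_minus)

lemma map_poly_of_rat_diff:
  "map_poly of_rat (p - q) = (map_poly of_rat p - map_poly of_rat q :: 'a :: field_char_0 poly)"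
  by (rule poly_eqI) (simp add: coeff_map_poly of_rat_diff)

lemma map_poly_of_rat_mult:
  "map_poly of_rat (p * q) = (map_poly of_rat p * map_poly of_rat q :: 'a :: field_char_0 poly)"
  by (rule poly_eqI) (simp add: coeff_map_poly coeff_mult of_rat_sum of_rat_mult)

lemma map_poly_of_rat_smult:
  "map_poly of_rat (smult c p) = (smult (of_rat c) (map_poly of_rat p) :: 'a :: field_char_0 poly)"
  by (rule poly_eqI) (simp add: coeff_map_poly of_rat_mult)

lemma degree_map_poly_of_rat [simp]:
  "degree (map_poly of_rat p :: 'a :: field_char_0 poly) = degree p"
  by (rule degree_map_poly) simp

lemma pderiv_map_poly_of_rat:
  "pderiv (map_poly of_rat p) = (map_poly of_rat (pderiv p) :: 'a :: field_char_0 poly)"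
  by (rule poly_eqI) (simp add: coeff_map_poly coeff_pderiv of_rat_mult of_rat_add)

lemmas map_poly_of_rat_simps =
  map_poly_of_rat_add map_poly_of_rat_minus map_poly_of_rat_diff map_poly_of_rat_mult
  map_poly_of_rat_smult map_poly_pCons map_poly_monom

lemma rpoly_complex_of_real:
  "rpoly p (complex_of_real x) = complex_of_real (rpoly p x)"
proof -
  have "of_rat a = complex_of_real (of_rat a)" for a
    by (cases a) (simp add: of_rat_rat)
  then show ?thesis
    by (induction p) (simp_all add: map_poly_pCons)
qed

section \<open>Minimal polynomials and Galois conjugates\<close>

lemma irreducible_bezout:
  fixes f g :: "rat poly"
  assumes "irreducible f" "\<not> f dvd g"
  obtains u v where "u * f + v * g = 1"
proof -
  have "coprime f g"
    using assms by (simp add: irreducible_imp_prime_elem prime_elem_imp_coprime)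
  then show thesis
    using that bezout_coefficients_fst_snd[of f g] by auto
qed

text \<open>Otherwise a Bezout relation between \<open>f\<close> and \<open>p\<close>, evaluated at
  \<open>x\<close>, would read 0 = 1.\<close>

lemma minimal_polynomial_dvd:
  assumes "is_minimal_polynomial f x" "rpoly p x = 0"
  shows "f dvd p"
proof (rule ccontr)
  assume "\<not> f dvd p"
  then obtain u v where "u * f + v * p = 1"
    using assms irreducible_bezout unfolding is_minimal_polynomial_def by metis
  then have "rpoly (u * f + v * p) x = 1"
    by simp
  with assms show False
    by (simp add: map_poly_of_rat_simps is_minimal_polynomial_def)
qed

text \<open>This carries any rational polynomial relation from \<beta> over to its
  conjugates.\<close>

lemma galois_conjugate_root:
  assumes "galois_conjugate x z" "rpoly p x = 0"
  shows "rpoly p z = 0"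
proof -
  obtain f where f: "is_minimal_polynomial f x" "rpoly f z = 0"
    using assms(1) by (auto simp: galois_conjugate_def)
  with assms(2) obtain k where "p = f * k"
    using minimal_polynomial_dvd by (metis dvdE)
  with f show ?thesis
    by (simp add: map_poly_of_rat_simps)
qed

text \<open>In characteristic 0 an irreducible \<open>f\<close> cannot divide its derivative, so a
  Bezout relation between the two excludes a common complex root.\<close>

lemma rsquarefree_minimal_polynomial:
  assumes "is_minimal_polynomial f x"
  shows "rsquarefree (map_poly of_rat f :: complex poly)"
proof -
  have f: "irreducible f" "f \<noteq> 0"
    using assms by (auto simp: is_minimal_polynomial_def)
  then have "degree f \<noteq> 0"
    by (metis is_unit_iff_degree irreducible_not_unit)
  then have "\<not> f dvd pderiv f"
    by (rule not_dvd_pderiv)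
  with f(1) obtain u v where "u * f + v * pderiv f = 1"
    by (rule irreducible_bezout)
  then have "rpoly (u * f + v * pderiv f) z = 1" for z :: complex
    by simp
  then show ?thesis
    unfolding rsquarefree_roots pderiv_map_poly_of_rat
    by (simp add: map_poly_of_rat_simps) (metis add_0 mult_zero_right zero_neq_one)
qed

text \<open>Supplies as many interpolation nodes as a polynomial of degree below
  \<open>degree f\<close> has coefficients; squarefreeness makes the linear factors
  distinct.\<close>

lemma card_roots_minimal_polynomial:
  assumes "is_minimal_polynomial f x"
  shows "card {z :: complex. rpoly f z = 0} = degree f"
proof -
  let ?F = "map_poly of_rat f :: complex poly"
  have "rsquarefree ?F"
    using assms by (rule rsquarefree_minimal_polynomial)
  from complex_poly_decompose_rsquarefree[OF this]
  have "degree ?F = degree (smult (lead_coeff ?F) (\<Prod>z | poly ?F z = 0. [:-z, 1:]))"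
    by simp
  also have "\<dots> = card {z. poly ?F z = 0}"
    using assms by (auto simp: degree_prod_sum_eq is_minimal_polynomial_def coeff_map_poly)
  finally show ?thesis by simp
qed

text \<open>An annihilating polynomial of least degree, made monic, is irreducible: in a
  factorization one factor again vanishes at \<open>x\<close>, so it has full degree and the other
  is constant.\<close>

lemma ex_minimal_polynomial:
  fixes x :: "'a :: field_char_0"
  assumes "p \<noteq> 0" "rpoly p x = 0"
  obtains f where "is_minimal_polynomial f x"
proof -
  define P where "P q \<longleftrightarrow> q \<noteq> 0 \<and> rpoly q x = 0" for q
  obtain f where f: "P f" "\<And>q. P q \<Longrightarrow> degree f \<le> degree q"
    using assms ex_has_least_nat[of P p degree] by (auto simp: P_def)
  define g where "g = smult (inverse (lead_coeff f)) f"
  have g: "P g" "lead_coeff g = 1" "\<And>q. P q \<Longrightarrow> degree g \<le> degree q"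
    using f by (auto simp: P_def g_def map_poly_of_rat_simps)
  have "irreducible g"
  proof (rule irreducibleI)
    show "g \<noteq> 0" using g(1) by (simp add: P_def)
    show "\<not> g dvd 1"
    proof
      assume "g dvd 1"
      then obtain k where "g * k = 1" by (metis dvdE)
      then have "rpoly (g * k) x = 1" by simp
      then show False using g(1) by (simp add: P_def map_poly_of_rat_simps)
    qed
    fix a b assume ab: "g = a * b"
    with \<open>g \<noteq> 0\<close> have nz: "a \<noteq> 0" "b \<noteq> 0" by auto
    have "P a \<or> P b"
      using g(1) nz by (auto simp: P_def ab map_poly_of_rat_simps)
    then have "degree g \<le> degree a \<or> degree g \<le> degree b"
      using g(3) by blast
    then show "a dvd 1 \<or> b dvd 1"
      using nz by (auto simp: ab degree_mult_eq is_unit_iff_degree)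
  qed
  with g show thesis
    by (intro that[of g]) (simp add: is_minimal_polynomial_def P_def)
qed

section \<open>Clearing denominators and Gauss's lemma\<close>

lemma ex_int_smult:
  fixes p :: "rat poly"
  obtains c :: int and P :: "int poly" where "c > 0" "smult (of_int c) p = map_poly of_int P"
proof -
  have "\<exists>c P. c > 0 \<and> smult (of_int c) p = map_poly of_int (P :: int poly)"
  proof (induction p)
    case 0
    show ?case by (intro exI[of _ 1] exI[of _ 0]) simp
  next
    case (pCons a p)
    then obtain c P where c: "c > 0" "smult (of_int c) p = map_poly of_int P" by blast
    obtain m n where a: "a = of_int m / of_int n" "n > 0"
      by (metis Fract_of_int_quotient quotient_of_unique)
    have "smult (of_int (c * n)) (pCons a p) = pCons (of_int (c * m)) (smult (of_int n) (smult (of_int c) p))"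
      using a by (simp add: mult.commute)
    also have "\<dots> = map_poly of_int (pCons (c * m) (smult n P))"
      unfolding c by (simp add: map_poly_pCons map_poly_smult)
    finally show ?case
      using c a by (intro exI[of _ "c * n"] exI[of _ "pCons (c * m) (smult n P)"]) auto
  qed
  then show thesis using that by blast
qed

text \<open>Gauss's lemma: clearing denominators in \<open>f * k = g\<close> by \<open>c\<close> and \<open>e\<close>, the contents of the
  two factors divide \<open>c\<close> and \<open>e\<close> and have product \<open>c * e\<close>.\<close>

lemma monic_dvd_int_poly:
  fixes f :: "rat poly" and g :: "int poly"
  assumes "lead_coeff f = 1" "lead_coeff g = 1" "f dvd map_poly of_int g"
  shows "coeff f i \<in> \<int>"
proof -
  let ?r = "map_poly of_int :: int poly \<Rightarrow> rat poly"
  have r_inj: "p = q" if "?r p = ?r q" for p q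
    using that by (auto simp: poly_eq_iff coeff_map_poly)
  have r_mult: "?r (p * q) = ?r p * ?r q" for p q
    by (rule poly_eqI) (simp add: coeff_map_poly coeff_mult)
  have r_smult: "?r (smult c p) = smult (of_int c) (?r p)" for c p
    by (rule poly_eqI) (simp add: coeff_map_poly)
  have r_lead: "lead_coeff (?r p) = of_int (lead_coeff p)" for p
    by (simp add: degree_map_poly coeff_map_poly)
  obtain k where k: "?r g = f * k"
    using assms(3) by (auto elim: dvdE)
  have "lead_coeff k = 1"
    using assms k r_lead[of g] by (simp add: lead_coeff_mult)
  obtain c H where c: "c > 0" "smult (of_int c) f = ?r H" by (rule ex_int_smult)
  obtain e K where e: "e > 0" "smult (of_int e) k = ?r K" by (rule ex_int_smult)
  have lc: "lead_coeff H = c" "lead_coeff K = e"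
    using assms(1) \<open>lead_coeff k = 1\<close> c e r_lead[of H] r_lead[of K]
    by (metis lead_coeff_smult mult.right_neutral of_int_eq_iff)+
  have "?r (H * K) = ?r (smult (c * e) g)"
    unfolding r_mult r_smult k c(2)[symmetric] e(2)[symmetric] by (simp add: mult_ac)
  then have "H * K = smult (c * e) g"
    by (rule r_inj)
  moreover have "content g = 1"
  proof -
    have "content g dvd 1"
      using content_dvd_coeff[of g "degree g"] assms(2) by simp
    then show ?thesis
      by (metis normalize_content is_unit_normalize)
  qed
  ultimately have prod: "content H * content K = c * e"
    using c(1) e(1) content_mult[of H K] by simp
  have dvd: "content H dvd c" "content K dvd e"
    using lc by (metis content_dvd_coeff)+
  \<comment> \<open>Cancelling \<open>content K\<close>, a divisor of \<open>e\<close>, from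
    \<open>content H * content K = c * e\<close> leaves a multiple of \<open>c\<close>.\<close>
  then have "c dvd content H"
  proof -
    obtain e' where e': "e = content K * e'"
      using dvd(2) by (auto elim: dvdE)
    have "content K \<noteq> 0"
      using e(1) e' by auto
    then have "content H = c * e'"
      using prod e' by auto
    then show ?thesis by simp
  qed
  then have "c dvd coeff H i"
    using content_dvd_coeff dvd_trans by blast
  then obtain m where "coeff H i = c * m" by (auto elim: dvdE)
  moreover have "of_int c * coeff f i = of_int (coeff H i)"
    using arg_cong[OF c(2), of "\<lambda>p. coeff p i"] by (simp add: coeff_map_poly)
  ultimately have "coeff f i = of_int m"
    using c(1) by simp
  then show ?thesis by simp
qed

lemma algebraic_int_minimal_polynomial:
  fixes x :: "'a :: field_char_0"
  assumes "algebraic_int x"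
  obtains f where "is_minimal_polynomial f x" "\<And>i. coeff f i \<in> \<int>"
proof -
  obtain g where g: "poly (map_poly of_int g) x = 0" "lead_coeff g = 1"
    using assms by (auto simp: algebraic_int_altdef_ipoly)
  define G where "G = map_poly (of_int :: int \<Rightarrow> rat) g"
  have "map_poly of_rat G = (map_poly of_int g :: 'a poly)"
    by (rule poly_eqI) (simp add: G_def coeff_map_poly)
  with g have G: "rpoly G x = 0" by simp
  have "G \<noteq> 0"
    using g(2) by (auto simp: G_def map_poly_eq_0_iff)
  then obtain f where f: "is_minimal_polynomial f x"
    using G by (rule ex_minimal_polynomial)
  moreover have "coeff f i \<in> \<int>" for i
    using f g(2) minimal_polynomial_dvd[OF f G]
    by (intro monic_dvd_int_poly[of f g]) (auto simp: is_minimal_polynomial_def G_def)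
  ultimately show thesis by (rule that)
qed

section \<open>The field generated by \<beta> as a set of polynomial values\<close>

text \<open>The polynomial values are already closed under inverses, because a Bezout relation with
  \<open>f\<close> inverts every nonzero value.\<close>

lemma rat_adjoin_eq_rpoly:
  assumes "is_minimal_polynomial f \<beta>"
  shows "rat_adjoin \<beta> = range (\<lambda>p. rpoly p \<beta>)"
proof
  show "rat_adjoin \<beta> \<subseteq> range (\<lambda>p. rpoly p \<beta>)"
  proof (rule rat_adjoin_minimal)
    show "\<beta> \<in> range (\<lambda>p. rpoly p \<beta>)"
      by (rule range_eqI[of _ _ "[:0, 1:]"]) (simp add: map_poly_pCons)
    show "1 \<in> range (\<lambda>p. rpoly p \<beta>)"
      by (rule range_eqI[of _ _ 1]) simp
    fix x assume "x \<in> range (\<lambda>p. rpoly p \<beta>)"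
    then obtain p where p: "x = rpoly p \<beta>" by auto
    show "- x \<in> range (\<lambda>p. rpoly p \<beta>)"
      by (rule range_eqI[of _ _ "- p"]) (simp add: p map_poly_of_rat_simps)
    show "inverse x \<in> range (\<lambda>p. rpoly p \<beta>)"
    proof (cases "f dvd p")
      case True
      then have "x = 0"
        using assms p by (auto elim!: dvdE simp: map_poly_of_rat_simps is_minimal_polynomial_def)
      then show ?thesis by (auto intro: range_eqI[of _ _ 0])
    next
      case False
      then obtain u v where "u * f + v * p = 1"
        using assms irreducible_bezout unfolding is_minimal_polynomial_def by metis
      then have "rpoly (u * f + v * p) \<beta> = 1" by simp
      then have "rpoly v \<beta> * x = 1"
        using assms by (simp add: p map_poly_of_rat_simps is_minimal_polynomial_def)
      then have "inverse x = rpoly v \<beta>"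
        by (metis inverse_unique mult.commute)
      then show ?thesis by simp
    qed
    fix y assume "y \<in> range (\<lambda>p. rpoly p \<beta>)"
    then obtain q where q: "y = rpoly q \<beta>" by auto
    show "x + y \<in> range (\<lambda>p. rpoly p \<beta>)"
      by (rule range_eqI[of _ _ "p + q"]) (simp add: p q map_poly_of_rat_simps)
    show "x * y \<in> range (\<lambda>p. rpoly p \<beta>)"
      by (rule range_eqI[of _ _ "p * q"]) (simp add: p q map_poly_of_rat_simps)
  qed
next
  have nat: "of_nat n \<in> rat_adjoin \<beta>" for n
    by (induction n) (auto intro: rat_adjoin_closed)
  have int: "of_int n \<in> rat_adjoin \<beta>" for n
    using nat rat_adjoin_closed(4)[OF nat] by (cases n) (auto simp del: of_nat_Suc)
  have rat: "of_rat r \<in> rat_adjoin \<beta>" for r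
    by (cases r) (use int in \<open>auto simp: of_rat_rat divide_inverse intro!: rat_adjoin_closed\<close>)
  have "rpoly p \<beta> \<in> rat_adjoin \<beta>" for p
    by (induction p) (auto simp: map_poly_pCons rat intro!: rat_adjoin_closed rat)
  then show "range (\<lambda>p. rpoly p \<beta>) \<subseteq> rat_adjoin \<beta>" by auto
qed

section \<open>Finiteness of sets of integral polynomials\<close>

lemma finite_int_poly_bounded_coeffs:
  fixes B :: rat
  shows "finite {p :: rat poly. degree p < d \<and> (\<forall>i. coeff p i \<in> \<int> \<and> \<bar>coeff p i\<bar> \<le> B)}"
    (is "finite ?S")
proof -
  define A where "A = {r :: rat. r \<in> \<int> \<and> \<bar>r\<bar> \<le> B}"
  have "A \<subseteq> of_int ` {- \<lfloor>B\<rfloor>..\<lfloor>B\<rfloor>}"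
  proof
    fix r assume "r \<in> A"
    then obtain n where n: "r = of_int n" "\<bar>r\<bar> \<le> B"
      by (auto simp: A_def Ints_def)
    then have "of_int n \<le> B" "of_int (- n) \<le> B"
      by auto
    then have "n \<le> \<lfloor>B\<rfloor>" "- n \<le> \<lfloor>B\<rfloor>"
      by (simp_all only: le_floor_iff)
    with n show "r \<in> of_int ` {- \<lfloor>B\<rfloor>..\<lfloor>B\<rfloor>}"
      by auto
  qed
  then have "finite A"
    by (rule finite_subset) simp
  then have "finite (Poly ` {xs. set xs \<subseteq> A \<and> length xs \<le> d})"
    by (intro finite_imageI finite_lists_length_le)
  moreover have "?S \<subseteq> Poly ` {xs. set xs \<subseteq> A \<and> length xs \<le> d}"
  proof
    fix p assume p: "p \<in> ?S"
    have "length (coeffs p) \<le> d"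
      using p by (cases "p = 0") (auto simp: length_coeffs_degree)
    moreover have "set (coeffs p) \<subseteq> A"
      using p by (auto simp: A_def coeffs_def)
    ultimately show "p \<in> Poly ` {xs. set xs \<subseteq> A \<and> length xs \<le> d}"
      by (intro image_eqI[of _ _ "coeffs p"]) auto
  qed
  ultimately show ?thesis by (rule finite_subset[rotated])
qed

lemma lagrange_basis:
  fixes G :: "'a :: field set"
  assumes "finite G" "\<gamma> \<in> G"
  obtains L where "degree L < card G" "\<And>\<delta>. \<delta> \<in> G \<Longrightarrow> poly L \<delta> = (if \<delta> = \<gamma> then 1 else 0)"
proof
  define P where "P = (\<Prod>\<delta>\<in>G - {\<gamma>}. [:- \<delta>, 1:])"
  define L where "L = smult (inverse (poly P \<gamma>)) P"
  have "poly P \<gamma> \<noteq> 0"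
    using assms by (simp add: P_def poly_prod)
  moreover have "poly P \<delta> = 0" if "\<delta> \<in> G" "\<delta> \<noteq> \<gamma>" for \<delta>
    using assms that by (auto simp: P_def poly_prod)
  ultimately show "poly L \<delta> = (if \<delta> = \<gamma> then 1 else 0)" if "\<delta> \<in> G" for \<delta>
    using that by (simp add: L_def)
  have "degree P \<le> card (G - {\<gamma>})"
    using degree_prod_sum_le[of "G - {\<gamma>}" "\<lambda>\<delta>. [:- \<delta>, 1:]"] assms by (simp add: P_def)
  then show "degree L < card G"
    using card_Diff1_less[OF assms] by (simp add: L_def)
qed

text \<open>A polynomial of degree below \<open>card G\<close> is the Lagrange interpolant of its
  values on \<open>G\<close>, so bounds on the values bound the coefficients.\<close>

lemma finite_int_poly_bounded_values:
  fixes G :: "complex set"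
  assumes "finite G"
  shows "finite {p :: rat poly. degree p < card G \<and> (\<forall>i. coeff p i \<in> \<int>) \<and>
    (\<forall>\<gamma>\<in>G. norm (rpoly p \<gamma>) \<le> M \<gamma>)}" (is "finite ?S")
proof -
  have "\<exists>L. \<forall>\<gamma>\<in>G. degree (L \<gamma>) < card G \<and>
      (\<forall>\<delta>\<in>G. poly (L \<gamma>) \<delta> = (if \<delta> = \<gamma> then 1 else 0))"
    using lagrange_basis[OF assms] by (intro bchoice) metis
  then obtain L where L: "\<And>\<gamma>. \<gamma> \<in> G \<Longrightarrow> degree (L \<gamma>) < card G"
    "\<And>\<gamma> \<delta>. \<gamma> \<in> G \<Longrightarrow> \<delta> \<in> G \<Longrightarrow> poly (L \<gamma>) \<delta> = (if \<delta> = \<gamma> then 1 else 0)"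
    by blast
  \<comment> \<open>\<open>C i\<close> bounds coefficient \<open>i\<close> of the interpolation
    formula; \<open>B\<close> is a rational bound that serves all \<open>i\<close> at once.\<close>
  define C where "C i = (\<Sum>\<gamma>\<in>G. M \<gamma> * norm (coeff (L \<gamma>) i))" for i
  define B :: rat where "B = of_int \<lceil>\<Sum>i<card G. \<bar>C i\<bar>\<rceil>"
  have "?S \<subseteq> {p :: rat poly. degree p < card G \<and> (\<forall>i. coeff p i \<in> \<int> \<and> \<bar>coeff p i\<bar> \<le> B)}"
  proof (intro subsetI CollectI conjI allI)
    fix p :: "rat poly" and i
    assume "p \<in> ?S"
    then show "degree p < card G" "coeff p i \<in> \<int>" by auto
    have p: "degree p < card G" "\<forall>\<gamma>\<in>G. norm (rpoly p \<gamma>) \<le> M \<gamma>"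
      using \<open>p \<in> ?S\<close> by auto
    let ?Q = "\<Sum>\<gamma>\<in>G. smult (rpoly p \<gamma>) (L \<gamma>)"
    have eq: "map_poly of_rat p = ?Q"
    proof (rule poly_eqI_degree[of G])
      fix \<delta> assume "\<delta> \<in> G"
      then show "rpoly p \<delta> = poly ?Q \<delta>"
        using assms by (simp add: poly_sum L(2) if_distrib[of "\<lambda>x. _ * x"] cong: if_cong)
    next
      show "card G > degree (map_poly of_rat p :: complex poly)" using p by simp
      show "card G > degree ?Q"
        using p L(1) by (intro degree_sum_less) (auto intro: le_less_trans[OF degree_smult_le])
    qed
    show "\<bar>coeff p i\<bar> \<le> B"
    proof (cases "i < card G")
      case False
      then have "coeff p i = 0" using p(1) by (simp add: coeff_eq_0)
      moreover have "0 \<le> (\<Sum>i<card G. \<bar>C i\<bar>)" by (rule sum_nonneg) simp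
      then have "- 1 < (\<Sum>i<card G. \<bar>C i\<bar>)" by linarith
      then have "B \<ge> 0" by (simp add: B_def)
      ultimately show ?thesis by simp
    next
      case True
      have "\<bar>of_rat (coeff p i)\<bar> = norm (of_rat (coeff p i) :: complex)"
        by (cases "coeff p i") (simp add: of_rat_rat norm_divide)
      also have "\<dots> = norm (coeff ?Q i)"
        by (simp add: eq[symmetric] coeff_map_poly)
      also have "\<dots> \<le> C i"
        unfolding C_def coeff_sum
        by (intro sum_norm_le) (use p(2) in \<open>auto simp: norm_mult intro!: mult_right_mono\<close>)
      also have "\<dots> \<le> (\<Sum>i<card G. \<bar>C i\<bar>)"
        using True member_le_sum[of i "{..<card G}" "\<lambda>i. \<bar>C i\<bar>"] by fastforce
      also have "\<dots> \<le> of_rat B"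
        by (simp add: B_def)
      finally have "\<bar>of_rat (coeff p i)\<bar> \<le> (of_rat B :: real)" .
      then have "of_rat \<bar>coeff p i\<bar> \<le> (of_rat B :: real)"
        by (metis abs_of_rat)
      then show ?thesis by (simp only: of_rat_less_eq)
    qed
  qed
  then show ?thesis
    by (rule finite_subset) (rule finite_int_poly_bounded_coeffs)
qed

section \<open>The map, its digits and the expansion of orbits\<close>

locale intermediate_beta_map =
  fixes \<beta> \<alpha> :: real and s :: sign
  assumes \<beta>_gt_1: "1 < \<beta>" and \<beta>_less_2: "\<beta> < 2" and \<alpha>_pos: "0 < \<alpha>" and \<alpha>_less: "\<alpha> < 2 - \<beta>"
begin

abbreviation T :: "real \<Rightarrow> real"
  where "T \<equiv> T_map s \<beta> \<alpha>"

text \<open>Rational values let the digits become coefficients of polynomials that are evaluated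
  both at \<beta> and at its conjugates.\<close>

definition digit :: "real \<Rightarrow> rat"
  where "digit x = (if x < crit \<beta> \<alpha> \<or> s = Minus \<and> x = crit \<beta> \<alpha> then 0 else 1)"

lemma T_eq: "T x = \<beta> * x + \<alpha> - of_rat (digit x)"
  unfolding digit_def by (cases s) auto

lemma digit_cases: "digit x = 0 \<or> digit x = 1"
  by (simp add: digit_def)

lemma norm_digit_le: "norm (of_rat (digit x) :: complex) \<le> 1"
  using digit_cases[of x] by auto

text \<open>Horner's scheme: the newest digit is the constant term, and \<open>pCons\<close>
  multiplies the earlier ones by the variable, as \<open>T\<close> multiplies by \<beta>.\<close>

primrec digit_poly :: "nat \<Rightarrow> real \<Rightarrow> rat poly" where
  "digit_poly 0 x = 0"
| "digit_poly (Suc n) x = pCons (digit ((T ^^ n) x)) (digit_poly n x)"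

lemma coeff_digit_poly_Ints: "coeff (digit_poly n x) i \<in> \<int>"
proof (induction n arbitrary: i)
  case (Suc n)
  then show ?case
    using digit_cases[of "(T ^^ n) x"] by (cases i) auto
qed simp

lemma coeff_digit_poly_eq_0: "n \<le> i \<Longrightarrow> coeff (digit_poly n x) i = 0"
  by (induction n arbitrary: i) (auto simp: coeff_pCons split: nat.split)

text \<open>Both orbits receive the same contribution from \<alpha>, so it cancels and only the
  digits remain.\<close>

lemma funpow_T_diff:
  "(T ^^ n) x - (T ^^ n) y = \<beta> ^ n * (x - y) - (rpoly (digit_poly n x) \<beta> - rpoly (digit_poly n y) \<beta>)"
proof (induction n)
  case (Suc n)
  have "(T ^^ Suc n) x - (T ^^ Suc n) y = \<beta> * ((T ^^ n) x - (T ^^ n) y)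
      - (of_rat (digit ((T ^^ n) x)) - of_rat (digit ((T ^^ n) y)))"
    by (simp add: T_eq algebra_simps)
  then show ?case
    unfolding Suc.IH by (simp add: map_poly_pCons algebra_simps)
qed simp

section \<open>Digit series in the base of a conjugate\<close>

text \<open>The digits produced by \<beta> are read in base \<gamma>. On
  \<open>J_int \<beta> \<alpha>\<close> the choice \<gamma> = \<beta> gives
  \<open>x + \<alpha> / (\<beta> - 1)\<close>, which suggests studying the difference from
  \<open>x\<close>.\<close>

definition digit_series :: "complex \<Rightarrow> real \<Rightarrow> complex"
  where "digit_series \<gamma> x = (\<Sum>k. of_rat (digit ((T ^^ k) x)) / \<gamma> ^ Suc k)"

lemma summable_inverse_power:
  fixes \<gamma> :: complex
  assumes "1 < norm \<gamma>"
  shows "summable (\<lambda>k. 1 / norm \<gamma> ^ Suc k)"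
proof -
  have "1 / norm \<gamma> < 1"
    by (subst divide_less_eq_1_pos) (use assms in linarith)+
  then have "summable (\<lambda>k. (1 / norm \<gamma>) ^ Suc k)"
    by (intro summable_ignore_initial_segment[of _ 1, simplified] summable_geometric) simp
  then show ?thesis by (simp add: power_divide)
qed

lemma norm_digit_series_term_le:
  "norm (of_rat (digit z) / \<gamma> ^ Suc k) \<le> 1 / norm (\<gamma> :: complex) ^ Suc k"
  using norm_digit_le[of z] by (simp add: norm_divide norm_mult norm_power divide_right_mono)

lemma summable_digit_series:
  assumes "1 < norm \<gamma>"
  shows "summable (\<lambda>k. of_rat (digit ((T ^^ k) x)) / \<gamma> ^ Suc k :: complex)"
  by (rule summable_comparison_test'[OF summable_inverse_power[OF assms] norm_digit_series_term_le])

text \<open>Multiplication by \<gamma> shifts the series by one place and releases the leading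
  digit.\<close>

lemma digit_series_T:
  assumes "1 < norm \<gamma>"
  shows "\<gamma> * digit_series \<gamma> x = of_rat (digit x) + digit_series \<gamma> (T x)"
proof -
  have "\<gamma> \<noteq> 0" using assms by auto
  let ?a = "\<lambda>x k. of_rat (digit ((T ^^ k) x)) / \<gamma> ^ Suc k"
  have "(\<Sum>k. \<gamma> * ?a x (Suc k)) = \<gamma> * (\<Sum>k. ?a x (Suc k))"
    using summable_digit_series[OF assms, of x] by (intro suminf_mult) (subst summable_Suc_iff)
  moreover have "\<gamma> * ?a x (Suc k) = ?a (T x) k" for k
    using \<open>\<gamma> \<noteq> 0\<close> by (simp add: funpow_swap1)
  ultimately have "digit_series \<gamma> (T x) = \<gamma> * (\<Sum>k. ?a x (Suc k))"
    by (simp add: digit_series_def)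
  moreover have "digit_series \<gamma> x = of_rat (digit x) / \<gamma> + (\<Sum>k. ?a x (Suc k))"
    using suminf_split_head[OF summable_digit_series[OF assms, of x]] by (simp add: digit_series_def)
  ultimately show ?thesis
    using \<open>\<gamma> \<noteq> 0\<close> by (simp only: distrib_left) simp
qed

lemma digit_series_funpow:
  assumes "1 < norm \<gamma>"
  shows "\<gamma> ^ n * digit_series \<gamma> x = rpoly (digit_poly n x) \<gamma> + digit_series \<gamma> ((T ^^ n) x)"
proof (induction n)
  case (Suc n)
  have "\<gamma> ^ Suc n * digit_series \<gamma> x = \<gamma> * (\<gamma> ^ n * digit_series \<gamma> x)"
    by simp
  also have "\<dots> = \<gamma> * rpoly (digit_poly n x) \<gamma> + \<gamma> * digit_series \<gamma> ((T ^^ n) x)"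
    unfolding Suc.IH by (simp add: distrib_left)
  also have "\<gamma> * digit_series \<gamma> ((T ^^ n) x) =
      of_rat (digit ((T ^^ n) x)) + digit_series \<gamma> ((T ^^ Suc n) x)"
    by (simp add: digit_series_T[OF assms])
  finally show ?case
    by (simp add: map_poly_pCons)
qed simp

section \<open>Relations between preperiodic points\<close>

text \<open>The pigeonhole principle is applied to the orbit of the pair \<open>(x, y)\<close>, so
  that the same two indices serve both points.\<close>

lemma common_preperiod:
  assumes "x \<in> Preper s \<beta> \<alpha>" "y \<in> Preper s \<beta> \<alpha>"
  obtains m n where "n < m" "(T ^^ m) x = (T ^^ n) x" "(T ^^ m) y = (T ^^ n) y"
proof -
  let ?f = "\<lambda>n. ((T ^^ n) x, (T ^^ n) y)"
  have "range ?f \<subseteq> range (\<lambda>n. (T ^^ n) x) \<times> range (\<lambda>n. (T ^^ n) y)"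
    by auto
  then have "finite (range ?f)"
    using assms by (rule_tac finite_subset) (auto simp: Preper_def)
  then have "\<not> inj ?f"
    using finite_imageD infinite_UNIV_nat by blast
  then obtain m n where "m \<noteq> n" "?f m = ?f n"
    by (auto simp: inj_def)
  then show thesis
    by (cases m n rule: linorder_cases) (auto intro: that simp: eq_commute)
qed

text \<open>The expansion of the difference of the orbits at time \<open>m\<close> minus that at
  time \<open>n\<close>, with \<open>r\<close> in place of \<open>x - y\<close>. Repetition of both
  orbits makes \<beta> a root.\<close>

definition preperiod_poly :: "rat \<Rightarrow> nat \<Rightarrow> nat \<Rightarrow> real \<Rightarrow> real \<Rightarrow> rat poly"
  where "preperiod_poly r m n x y = smult r (monom 1 m - monom 1 n)
    - (digit_poly m x - digit_poly m y) + (digit_poly n x - digit_poly n y)"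

lemma preperiod_poly_root:
  assumes "(T ^^ m) x = (T ^^ n) x" "(T ^^ m) y = (T ^^ n) y" "x - y = of_rat r"
  shows "rpoly (preperiod_poly r m n x y) \<beta> = 0"
  using funpow_T_diff[of m x y] funpow_T_diff[of n x y] assms
  by (simp add: preperiod_poly_def map_poly_of_rat_simps poly_monom algebra_simps)

text \<open>The polynomial relation at \<beta> passes to \<gamma>. There the digit polynomials are
  truncations of the digit series, scaled by a power of \<gamma>, and the tails cancel because both
  orbits repeat.\<close>

lemma digit_series_diff_Rats:
  assumes "x \<in> Preper s \<beta> \<alpha>" "y \<in> Preper s \<beta> \<alpha>" "x \<in> \<rat>" "y \<in> \<rat>"
    and "galois_conjugate \<beta> \<gamma>" "1 < norm \<gamma>"
  shows "digit_series \<gamma> x - digit_series \<gamma> y = complex_of_real (x - y)"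
proof -
  obtain m n where mn: "n < m" "(T ^^ m) x = (T ^^ n) x" "(T ^^ m) y = (T ^^ n) y"
    using common_preperiod[OF assms(1,2)] .
  obtain r where r: "x - y = of_rat r"
    using assms(3,4) Rats_diff by (metis Rats_cases)
  have "rpoly (preperiod_poly r m n x y) \<gamma> = 0"
    using galois_conjugate_root[OF assms(5)] preperiod_poly_root[OF mn(2,3) r] .
  then have "(\<gamma> ^ m - \<gamma> ^ n) * of_rat r = (\<gamma> ^ m - \<gamma> ^ n) * (digit_series \<gamma> x - digit_series \<gamma> y)"
    using digit_series_funpow[OF assms(6), of m x] digit_series_funpow[OF assms(6), of n x]
      digit_series_funpow[OF assms(6), of m y] digit_series_funpow[OF assms(6), of n y] mn(2,3)
    by (simp add: preperiod_poly_def map_poly_of_rat_simps poly_monom algebra_simps)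
  moreover have "\<gamma> ^ m \<noteq> \<gamma> ^ n"
    using mn(1) assms(6) by (metis norm_power order_less_irrefl power_strict_increasing_iff)
  moreover have "of_rat r = complex_of_real (x - y)"
    unfolding r using rpoly_complex_of_real[of "[:r:]" 0] by (simp add: map_poly_pCons)
  ultimately show ?thesis by simp
qed

section \<open>One-sided limits of orbits and digit series\<close>

text \<open>\<open>T\<close> and the digits are continuous from the right for \<open>Plus\<close> and from the left for \<open>Minus\<close>.\<close>

definition side :: "real \<Rightarrow> real filter"
  where "side a = at a within (if s = Plus then {a<..} else {..<a})"

lemma side_neq_bot [simp]: "side a \<noteq> bot"
  by (simp add: side_def)

lemma eventually_side_ball:
  assumes "0 < e"
  shows "eventually (\<lambda>z. \<bar>z - a\<bar> < e) (side a)"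
  using assms unfolding side_def eventually_at by (auto simp: dist_real_def)

lemma eventually_side_Rats:
  assumes "eventually P (side a)"
  obtains z where "z \<in> \<rat>" "P z"
proof (cases "s = Plus")
  case True
  with assms have "eventually P (at_right a)"
    unfolding side_def by simp
  then obtain b where "a < b" "\<And>y. a < y \<Longrightarrow> y < b \<Longrightarrow> P y"
    by (auto simp: eventually_at_right_field)
  then show thesis
    using Rats_dense_in_real[of a b] that by blast
next
  case False
  with assms have "eventually P (at_left a)"
    unfolding side_def by simp
  then obtain b where "b < a" "\<And>y. b < y \<Longrightarrow> y < a \<Longrightarrow> P y"
    by (auto simp: eventually_at_left_field)
  then show thesis
    using Rats_dense_in_real[of b a] that by blast
qed

lemma eventually_side_order:
  "eventually (\<lambda>z. if s = Plus then a < z else z < a) (side a)"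
  by (simp add: side_def eventually_at_filter)

text \<open>Away from the discontinuity the digit is locally constant; at the discontinuity its
  value is that of the side from which \<open>side\<close> approaches.\<close>

lemma eventually_digit_side: "eventually (\<lambda>z. digit z = digit a) (side a)"
proof (cases "a = crit \<beta> \<alpha>")
  case True
  show ?thesis
    using eventually_side_order[of a]
    unfolding digit_def True by eventually_elim (cases s; auto)
next
  case False
  then have "eventually (\<lambda>z. \<bar>z - a\<bar> < \<bar>a - crit \<beta> \<alpha>\<bar>) (side a)"
    by (intro eventually_side_ball) simp
  then show ?thesis
    by eventually_elim (use False in \<open>auto simp: digit_def\<close>)
qed

text \<open>Both branches are strictly increasing, so the images approach \<open>T a\<close> from
  the same side. Having \<open>side\<close> on both ends is what lets the limit be iterated.\<close>

lemma filterlim_T_side: "filterlim T (side (T a)) (side a)"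
proof -
  have "((\<lambda>z. \<beta> * z + \<alpha> - of_rat (digit a)) \<longlongrightarrow> T a) (side a)"
    unfolding T_eq side_def by (intro tendsto_intros)
  moreover have eq: "eventually (\<lambda>z. T z = \<beta> * z + \<alpha> - of_rat (digit a)) (side a)"
    using eventually_digit_side[of a] by eventually_elim (simp add: T_eq)
  ultimately have lim: "(T \<longlongrightarrow> T a) (side a)"
    by (subst tendsto_cong[OF eq])
  have mono: "t \<in> (if P then {u<..} else {..<u}) \<and> t \<noteq> u"
    if "t - u = \<beta> * (z - a)" "if P then a < z else z < a" for t u z P
  proof -
    have "u < t \<longleftrightarrow> 0 < \<beta> * (z - a)" "t < u \<longleftrightarrow> \<beta> * (z - a) < 0"
      unfolding that(1)[symmetric] by simp_all
    then have "u < t \<longleftrightarrow> a < z" "t < u \<longleftrightarrow> z < a"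
      using \<beta>_gt_1 by (simp_all add: zero_less_mult_iff mult_less_0_iff)
    with that(2) show ?thesis by (auto split: if_splits)
  qed
  have "eventually (\<lambda>z. T z \<in> (if s = Plus then {T a<..} else {..<T a}) \<and> T z \<noteq> T a) (side a)"
    using eq eventually_side_order[of a]
    by eventually_elim (rule mono, simp_all add: T_eq[of a] algebra_simps)
  with lim show ?thesis
    unfolding side_def[of "T a"] filterlim_at by simp
qed

lemma filterlim_funpow_T_side: "filterlim (T ^^ n) (side ((T ^^ n) a)) (side a)"
proof (induction n)
  case (Suc n)
  show ?case
    using filterlim_compose[OF filterlim_T_side Suc.IH] by (simp add: o_def)
qed (simp add: id_def filterlim_ident)

text \<open>Each single digit is eventually constant along \<open>side a\<close>, and a geometric
  series dominates the terms, so Tannery's theorem exchanges limit and sum.\<close>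

lemma tendsto_digit_series_side:
  assumes "1 < norm \<gamma>"
  shows "(digit_series \<gamma> \<longlongrightarrow> digit_series \<gamma> a) (side a)"
proof -
  have "eventually (\<lambda>z. digit ((T ^^ k) z) = digit ((T ^^ k) a)) (side a)" for k
    using eventually_digit_side filterlim_funpow_T_side
    by (rule eventually_compose_filterlim)
  then have "((\<lambda>z. of_rat (digit ((T ^^ k) z)) / \<gamma> ^ Suc k) \<longlongrightarrow>
      of_rat (digit ((T ^^ k) a)) / \<gamma> ^ Suc k) (side a)" for k
    by (intro tendsto_eventually) (auto elim: eventually_mono)
  then show ?thesis
    unfolding digit_series_def
    by (rule tannerys_theorem[THEN conjunct2, THEN conjunct2])
       (use norm_digit_series_term_le summable_inverse_power[OF assms]
        in \<open>auto intro!: always_eventually simp del: power_Suc\<close>)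
qed

section \<open>Conjugates of \<beta> when all rational points are preperiodic\<close>

lemma in_J_int_if_le_1: "- \<alpha> / (\<beta> - 1) < x \<Longrightarrow> x \<le> 1 \<Longrightarrow> x \<in> J_int \<beta> \<alpha>"
proof -
  have "1 \<le> (1 - \<alpha>) / (\<beta> - 1)"
    using \<beta>_gt_1 \<alpha>_less by (simp add: field_simps)
  then show "- \<alpha> / (\<beta> - 1) < x \<Longrightarrow> x \<le> 1 \<Longrightarrow> x \<in> J_int \<beta> \<alpha>"
    by (simp add: J_int_def)
qed

lemma zero_one_in_J_int: "0 \<in> J_int \<beta> \<alpha>" "1 \<in> J_int \<beta> \<alpha>"
proof -
  have "- \<alpha> / (\<beta> - 1) < 0"
    using \<beta>_gt_1 \<alpha>_pos by simp
  then show "0 \<in> J_int \<beta> \<alpha>" "1 \<in> J_int \<beta> \<alpha>"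
    by (simp_all add: in_J_int_if_le_1)
qed

text \<open>If the identity failed at \<open>x\<close>, one-sided continuity would make it fail at a
  rational point nearby, where comparison with the rational point 0 proves it.\<close>

lemma digit_series_eq:
  assumes "\<rat> \<inter> J_int \<beta> \<alpha> \<subseteq> Preper s \<beta> \<alpha>"
    and "galois_conjugate \<beta> \<gamma>" "1 < norm \<gamma>" "0 \<le> x" "x < 1"
  shows "digit_series \<gamma> x = complex_of_real x + digit_series \<gamma> 0"
proof (rule ccontr)
  assume neq: "digit_series \<gamma> x \<noteq> complex_of_real x + digit_series \<gamma> 0"
  have id: "((\<lambda>z. z) \<longlongrightarrow> x) (side x)"
    unfolding side_def by (rule tendsto_ident_at)
  have "((\<lambda>z. digit_series \<gamma> z - complex_of_real z) \<longlongrightarrow> digit_series \<gamma> x - complex_of_real x) (side x)"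
    by (intro tendsto_diff tendsto_of_real tendsto_digit_series_side assms id)
  then have "eventually (\<lambda>z. digit_series \<gamma> z - complex_of_real z \<noteq> digit_series \<gamma> 0) (side x)"
    using neq by (intro tendsto_imp_eventually_ne) (auto simp: algebra_simps)
  \<comment> \<open>The bounds \<open>0 \<le> x\<close> and \<open>x < 1\<close> leave room inside
    \<open>J_int \<beta> \<alpha>\<close> on either side of \<open>x\<close>, whichever the
    sign.\<close>
  moreover have "eventually (\<lambda>z. z \<in> J_int \<beta> \<alpha>) (side x)"
  proof -
    have "- \<alpha> / (\<beta> - 1) < x"
      using assms(4) \<alpha>_pos \<beta>_gt_1 by (auto intro: less_le_trans[of _ 0])
    from order_tendstoD(1)[OF id this] order_tendstoD(2)[OF id assms(5)] show ?thesis
      by (rule eventually_elim2) (rule in_J_int_if_le_1, auto)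
  qed
  ultimately have "eventually (\<lambda>z. digit_series \<gamma> z - complex_of_real z \<noteq> digit_series \<gamma> 0
      \<and> z \<in> J_int \<beta> \<alpha>) (side x)"
    by (rule eventually_conj)
  then obtain z where z: "z \<in> \<rat>"
      "digit_series \<gamma> z - complex_of_real z \<noteq> digit_series \<gamma> 0 \<and> z \<in> J_int \<beta> \<alpha>"
    by (rule eventually_side_Rats)
  have "digit_series \<gamma> z - digit_series \<gamma> 0 = complex_of_real (z - 0)"
    by (rule digit_series_diff_Rats) (use assms z zero_one_in_J_int in auto)
  with z(2) show False by (simp add: algebra_simps)
qed

lemma galois_conjugate_norm_le_1:
  assumes "\<rat> \<inter> J_int \<beta> \<alpha> \<subseteq> Preper s \<beta> \<alpha>"
    and "galois_conjugate \<beta> \<gamma>" "\<gamma> \<noteq> complex_of_real \<beta>"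
  shows "norm \<gamma> \<le> 1"
proof (rule ccontr)
  assume "\<not> norm \<gamma> \<le> 1"
  then have \<gamma>: "1 < norm \<gamma>" by simp
  \<comment> \<open>Half of the discontinuity has first digit 0 for both signs, and its image
    \<open>(1 + \<alpha>) / 2\<close> stays in the range where \<open>digit_series_eq\<close>
    applies.\<close>
  define p where "p = crit \<beta> \<alpha> / 2"
  have p: "0 < p" "p < crit \<beta> \<alpha>" "p < 1" "\<beta> * p + \<alpha> < 1"
    using \<beta>_gt_1 \<alpha>_pos \<alpha>_less by (auto simp: p_def crit_def field_simps)
  have *: "\<gamma> * (complex_of_real x + digit_series \<gamma> 0)
      = complex_of_real (\<beta> * x + \<alpha>) + digit_series \<gamma> 0" if "x = 0 \<or> x = p" for x
  proof -
    have x: "0 \<le> x" "x < 1" "x < crit \<beta> \<alpha>" "0 \<le> \<beta> * x + \<alpha>" "\<beta> * x + \<alpha> < 1"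
      using that p \<beta>_gt_1 \<alpha>_pos \<alpha>_less by auto
    have "\<gamma> * digit_series \<gamma> x = digit_series \<gamma> (\<beta> * x + \<alpha>)"
      using digit_series_T[OF \<gamma>, of x] x(3) by (simp add: T_eq digit_def)
    then show ?thesis
      using digit_series_eq[OF assms(1,2) \<gamma> x(1,2)] digit_series_eq[OF assms(1,2) \<gamma> x(4,5)] by simp
  qed
  \<comment> \<open>Subtracting the instance at 0 from the one at \<open>p\<close> removes the
    constants and leaves only the slopes \<gamma> and \<beta>.\<close>
  have "\<gamma> * complex_of_real p = complex_of_real \<beta> * complex_of_real p"
    using *[of p] *[of 0] by (simp add: algebra_simps)
  with p(1) assms(3) show False by simp
qed

text \<open>The points 1 and 0 differ by 1, so their preperiod polynomial is integral; it is monic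
  of degree \<open>m\<close> because the digit polynomials have lower degree.\<close>

lemma algebraic_int_base:
  assumes "\<rat> \<inter> J_int \<beta> \<alpha> \<subseteq> Preper s \<beta> \<alpha>"
  shows "algebraic_int \<beta>"
proof -
  have "1 \<in> Preper s \<beta> \<alpha>" "0 \<in> Preper s \<beta> \<alpha>"
    using assms zero_one_in_J_int by auto
  then obtain m n where mn: "n < m" "(T ^^ m) 1 = (T ^^ n) 1" "(T ^^ m) 0 = (T ^^ n) 0"
    by (rule common_preperiod)
  let ?P = "preperiod_poly 1 m n 1 0"
  have "coeff ?P m = 1"
    using mn(1) by (simp add: preperiod_poly_def coeff_digit_poly_eq_0)
  moreover have "coeff ?P i = 0" if "i > m" for i
    using mn(1) that by (simp add: preperiod_poly_def coeff_digit_poly_eq_0)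
  ultimately have "degree ?P = m"
    by (intro antisym degree_le le_degree) auto
  with \<open>coeff ?P m = 1\<close> have lead: "lead_coeff ?P = 1" by simp
  have "coeff ?P i \<in> \<int>" for i
    by (auto simp: preperiod_poly_def coeff_digit_poly_Ints intro!: Ints_add Ints_diff)
  then have "of_rat (coeff ?P i) \<in> (\<int> :: real set)" for i
    by (metis Ints_cases Ints_of_int of_rat_of_int_eq)
  then show ?thesis
    using lead preperiod_poly_root[OF mn(2,3), of 1]
    by (intro algebraic_int.intros[of "map_poly of_rat ?P"]) (auto simp: coeff_map_poly)
qed

section \<open>Preperiodic points lie in the number field\<close>

text \<open>The offset accumulated from \<alpha> and the digits stays in the field even when
  \<open>x\<close> lies outside it.\<close>

lemma funpow_T_affine:
  assumes "\<alpha> \<in> rat_adjoin \<beta>"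
  shows "(T ^^ n) x - \<beta> ^ n * x \<in> rat_adjoin \<beta>"
proof (induction n)
  case (Suc n)
  have "of_rat (digit z) \<in> rat_adjoin \<beta>" for z
    using digit_cases[of z] rat_adjoin_closed(2,3)[of \<beta>] by auto
  then have "\<beta> * ((T ^^ n) x - \<beta> ^ n * x) + (\<alpha> + - of_rat (digit ((T ^^ n) x))) \<in> rat_adjoin \<beta>"
    by (intro rat_adjoin_closed Suc.IH assms)
  then show ?case
    by (simp add: T_eq[of "(T ^^ n) x"] algebra_simps)
qed (simp add: rat_adjoin_closed)

text \<open>A repetition in the orbit is a linear equation for \<open>x\<close> over the field,
  whose leading coefficient \<open>\<beta> ^ m - \<beta> ^ n\<close> is nonzero because \<beta>
  exceeds 1.\<close>

lemma Preper_subset_rat_adjoin: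
  assumes "\<alpha> \<in> rat_adjoin \<beta>"
  shows "Preper s \<beta> \<alpha> \<subseteq> rat_adjoin \<beta>"
proof
  fix x assume "x \<in> Preper s \<beta> \<alpha>"
  then obtain m n where mn: "n < m" "(T ^^ m) x = (T ^^ n) x"
    using common_preperiod by metis
  have pow: "\<beta> ^ k \<in> rat_adjoin \<beta>" for k
    by (induction k) (auto intro: rat_adjoin_closed)
  let ?c = "\<lambda>k. (T ^^ k) x - \<beta> ^ k * x"
  have "(?c n + - ?c m) * inverse (\<beta> ^ m + - (\<beta> ^ n)) \<in> rat_adjoin \<beta>"
    by (intro rat_adjoin_closed funpow_T_affine assms pow)
  moreover have "?c n + - ?c m = x * (\<beta> ^ m + - (\<beta> ^ n))"
    using mn(2) by (simp add: algebra_simps)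
  moreover have "\<beta> ^ m + - (\<beta> ^ n) \<noteq> 0"
    using mn(1) \<beta>_gt_1 power_strict_increasing[of n m \<beta>] by simp
  ultimately show "x \<in> rat_adjoin \<beta>"
    by (simp only: mult.assoc right_inverse mult_1_right not_False_eq_True)
qed

section \<open>Finite orbits for a Pisot number\<close>

lemma funpow_T_in_J_int: "x \<in> J_int \<beta> \<alpha> \<Longrightarrow> (T ^^ n) x \<in> J_int \<beta> \<alpha>"
  using T_map_in_J \<beta>_gt_1 \<beta>_less_2 \<alpha>_pos \<alpha>_less by (induction n) auto

text \<open>Scaled by the common denominator \<open>q\<close>, the whole orbit is tracked by
  integral polynomials of degree below \<open>degree F\<close>. The condition on \<open>M\<close>
  says that one step at a conjugate maps the disc of radius \<open>M \<gamma>\<close> into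
  itself.\<close>

lemma funpow_T_int_poly:
  assumes F: "is_minimal_polynomial F \<beta>" "\<And>i. coeff F i \<in> \<int>"
    and A: "degree A < degree F" "\<And>i. coeff A i \<in> \<int>" "rpoly A \<beta> = of_int q * \<alpha>"
    and R: "degree R < degree F" "\<And>i. coeff R i \<in> \<int>" "rpoly R \<beta> = of_int q * x"
    and "q > 0"
    and R_bound: "\<And>\<gamma>. rpoly F \<gamma> = 0 \<Longrightarrow> \<gamma> \<noteq> complex_of_real \<beta> \<Longrightarrow> norm (rpoly R \<gamma>) \<le> M \<gamma>"
    and M: "\<And>\<gamma>. rpoly F \<gamma> = 0 \<Longrightarrow> \<gamma> \<noteq> complex_of_real \<beta> \<Longrightarrow>
      norm \<gamma> * M \<gamma> + norm (rpoly A \<gamma>) + of_int q \<le> M \<gamma>"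
  shows "\<exists>R. degree R < degree F \<and> (\<forall>i. coeff R i \<in> \<int>) \<and> rpoly R \<beta> = of_int q * (T ^^ n) x \<and>
    (\<forall>\<gamma>. rpoly F \<gamma> = 0 \<and> \<gamma> \<noteq> complex_of_real \<beta> \<longrightarrow> norm (rpoly R \<gamma>) \<le> M \<gamma>)"
proof (induction n)
  case 0
  show ?case using R R_bound by auto
next
  case (Suc n)
  then obtain S where S: "degree S < degree F" "\<And>i. coeff S i \<in> \<int>"
      "rpoly S \<beta> = of_int q * (T ^^ n) x"
      "\<And>\<gamma>. rpoly F \<gamma> = 0 \<Longrightarrow> \<gamma> \<noteq> complex_of_real \<beta> \<Longrightarrow> norm (rpoly S \<gamma>) \<le> M \<gamma>"
    by blast
  define d where "d = digit ((T ^^ n) x)"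
  \<comment> \<open>One step of \<open>T\<close>, scaled by \<open>q\<close>: multiply by the
    variable, add \<open>A\<close>, subtract the digit. The multiple of the monic \<open>F\<close>
    removes the term of degree \<open>degree F\<close> and vanishes at every conjugate.\<close>
  define S' where "S' = pCons 0 S - smult (coeff S (degree F - 1)) F + A - [:of_int q * d:]"
  have d: "d = 0 \<or> d = 1"
    unfolding d_def by (rule digit_cases)
  have rpoly_S': "rpoly S' z = z * rpoly S z + rpoly A z - of_int q * of_rat d"
    if "rpoly F z = 0" for z :: "'b :: field_char_0"
    using that by (simp add: S'_def map_poly_of_rat_simps of_rat_mult)
  show ?case
  proof (intro exI[of _ S'] conjI allI impI)
    have "coeff S' i = 0" if "degree F \<le> i" for i
    proof (cases "i = degree F")
      case True
      obtain k where "degree F = Suc k"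
        using S(1) by (cases "degree F") auto
      with True show ?thesis
        using F(1) A(1) S(1) by (simp add: S'_def coeff_eq_0 is_minimal_polynomial_def)
    next
      case False
      then show ?thesis
        using that A(1) S(1)
        by (cases i) (auto simp: S'_def coeff_eq_0)
    qed
    then show "degree S' < degree F"
      using S(1) by (intro degree_lessI) auto
    show "coeff S' i \<in> \<int>" for i
      using d S(2) F(2) A(2)
      by (cases i) (auto simp: S'_def coeff_pCons split: nat.split intro!: Ints_add Ints_diff Ints_mult)
    have "rpoly F \<beta> = 0"
      using F(1) by (simp add: is_minimal_polynomial_def)
    from rpoly_S'[OF this] show "rpoly S' \<beta> = of_int q * (T ^^ Suc n) x"
      using A(3) S(3) by (simp add: T_eq[of "(T ^^ n) x"] d_def algebra_simps)
    fix \<gamma> assume \<gamma>: "rpoly F \<gamma> = 0 \<and> \<gamma> \<noteq> complex_of_real \<beta>"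
    have "norm (rpoly S' \<gamma>) \<le> norm \<gamma> * norm (rpoly S \<gamma>) + norm (rpoly A \<gamma>) + norm (of_int q * of_rat d :: complex)"
      unfolding rpoly_S'[OF conjunct1[OF \<gamma>]] norm_mult[symmetric]
      by (intro order_trans[OF norm_triangle_ineq4] add_mono norm_triangle_ineq order_refl)
    also have "\<dots> \<le> norm \<gamma> * M \<gamma> + norm (rpoly A \<gamma>) + of_int q"
      using d \<open>q > 0\<close> S(4) \<gamma> by (intro add_mono mult_left_mono) auto
    also have "\<dots> \<le> M \<gamma>"
      using M \<gamma> by blast
    finally show "norm (rpoly S' \<gamma>) \<le> M \<gamma>" .
  qed
qed

text \<open>Every point of the orbit is a value at \<beta>, divided by \<open>q\<close>, of a
  polynomial in one finite set: the interval bounds these polynomials at \<beta>, and contraction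
  bounds them at the other conjugates.\<close>

lemma rat_adjoin_subset_Preper:
  assumes "pisot_number \<beta>" "\<alpha> \<in> rat_adjoin \<beta>" "x \<in> rat_adjoin \<beta>" "x \<in> J_int \<beta> \<alpha>"
  shows "x \<in> Preper s \<beta> \<alpha>"
proof -
  obtain F where F: "is_minimal_polynomial F \<beta>" "\<And>i. coeff F i \<in> \<int>"
    using assms(1) algebraic_int_minimal_polynomial unfolding pisot_number_def by blast
  have F0: "rpoly F \<beta> = 0" "F \<noteq> 0"
    using F(1) by (auto simp: is_minimal_polynomial_def)
  have "degree F > 0"
    using F(1) by (metis F0(2) gr0I irreducible_not_unit is_minimal_polynomial_def is_unit_iff_degree)
  have red: "\<exists>p. degree p < degree F \<and> y = rpoly p \<beta>" if y: "y \<in> rat_adjoin \<beta>" for y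
  proof -
    obtain p where p: "y = rpoly p \<beta>"
      using y rat_adjoin_eq_rpoly[OF F(1)] by auto
    have "rpoly p \<beta> = rpoly (p div F * F + p mod F) \<beta>" by simp
    also have "\<dots> = rpoly (p mod F) \<beta>"
      by (simp only: map_poly_of_rat_add map_poly_of_rat_mult poly_add poly_mult F0(1) mult_zero_right add_0)
    finally show ?thesis
      using p degree_mod_less[OF F0(2), of p] \<open>degree F > 0\<close> by (intro exI[of _ "p mod F"]) auto
  qed
  obtain a p where ap: "degree a < degree F" "\<alpha> = rpoly a \<beta>" "degree p < degree F" "x = rpoly p \<beta>"
    using red assms(2,3) by blast
  obtain c C where c: "c > 0" "smult (of_int c) a = map_poly of_int C"
    by (rule ex_int_smult)
  obtain e E where e: "e > 0" "smult (of_int e) p = map_poly of_int E"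
    by (rule ex_int_smult)
  \<comment> \<open>A common denominator for \<alpha> and \<open>x\<close>.\<close>
  define q where "q = c * e"
  have "q > 0" using c e by (simp add: q_def)
  define A R where "A = smult (of_int q) a" and "R = smult (of_int q) p"
  have A: "degree A < degree F" "rpoly A \<beta> = of_int q * \<alpha>"
    and R: "degree R < degree F" "rpoly R \<beta> = of_int q * x"
    using ap \<open>q > 0\<close> by (simp_all add: A_def R_def map_poly_of_rat_simps)
  have "A = smult (of_int e) (map_poly of_int C)"
    "R = smult (of_int c) (map_poly of_int E)"
    unfolding c(2)[symmetric] e(2)[symmetric] by (simp_all add: A_def R_def q_def mult.commute)
  then have ints: "coeff A i \<in> \<int>" "coeff R i \<in> \<int>" for i
    by (simp_all add: coeff_map_poly)
  define B where "B = max \<bar>\<alpha> / (\<beta> - 1)\<bar> \<bar>(1 - \<alpha>) / (\<beta> - 1)\<bar>"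
  \<comment> \<open>At \<beta> the bound comes from the interval. Elsewhere it is the larger of the
    initial value and the fixed point of the map that sends \<open>t\<close> to
    \<open>norm \<gamma> * t + norm (rpoly A \<gamma>) + q\<close>, a contraction since \<beta> is
    Pisot.\<close>
  define M where "M \<gamma> = (if \<gamma> = complex_of_real \<beta> then of_int q * B else
      max (norm (rpoly R \<gamma>)) ((norm (rpoly A \<gamma>) + of_int q) / (1 - norm \<gamma>)))" for \<gamma>
  have R_bound: "norm (rpoly R \<gamma>) \<le> M \<gamma>" if "\<gamma> \<noteq> complex_of_real \<beta>" for \<gamma>
    using that by (simp add: M_def)
  have M: "norm \<gamma> * M \<gamma> + norm (rpoly A \<gamma>) + of_int q \<le> M \<gamma>"
    if "rpoly F \<gamma> = 0" "\<gamma> \<noteq> complex_of_real \<beta>" for \<gamma>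
  proof -
    have "norm \<gamma> < 1"
      using assms(1) F(1) that by (auto simp: pisot_number_def galois_conjugate_def)
    moreover have "(norm (rpoly A \<gamma>) + of_int q) / (1 - norm \<gamma>) \<le> M \<gamma>"
      using that by (simp add: M_def)
    ultimately show ?thesis
      by (simp add: field_simps)
  qed
  define G where "G = {z :: complex. rpoly F z = 0}"
  define P where "P = {p :: rat poly. degree p < card G \<and> (\<forall>i. coeff p i \<in> \<int>) \<and>
    (\<forall>\<gamma>\<in>G. norm (rpoly p \<gamma>) \<le> M \<gamma>)}"
  have G: "card G = degree F"
    unfolding G_def by (rule card_roots_minimal_polynomial[OF F(1)])
  have "finite P"
    unfolding P_def by (rule finite_int_poly_bounded_values) (use G \<open>degree F > 0\<close> card_gt_0_iff in force)
  moreover have "range (\<lambda>n. (T ^^ n) x) \<subseteq> (\<lambda>p. rpoly p \<beta> / of_int q) ` P"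
  proof safe
    fix n
    obtain S where S: "degree S < degree F" "\<And>i. coeff S i \<in> \<int>"
        "rpoly S \<beta> = of_int q * (T ^^ n) x"
        "\<And>\<gamma>. rpoly F \<gamma> = 0 \<Longrightarrow> \<gamma> \<noteq> complex_of_real \<beta> \<Longrightarrow> norm (rpoly S \<gamma>) \<le> M \<gamma>"
      using funpow_T_int_poly[OF F A(1) ints(1) A(2) R(1) ints(2) R(2) \<open>q > 0\<close> R_bound M]
      by blast
    have "\<bar>(T ^^ n) x\<bar> \<le> B"
      using funpow_T_in_J_int[OF assms(4), of n]
      unfolding J_int_def B_def atLeastAtMost_iff by linarith
    then have "norm (rpoly S (complex_of_real \<beta>)) \<le> M (complex_of_real \<beta>)"
      using \<open>q > 0\<close> by (simp add: M_def rpoly_complex_of_real S(3) norm_mult)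
    with S have "S \<in> P"
      unfolding P_def G_def[symmetric] G by (auto simp: G_def)
    then show "(T ^^ n) x \<in> (\<lambda>p. rpoly p \<beta> / of_int q) ` P"
      using S(3) \<open>q > 0\<close> by (intro image_eqI[of _ _ S]) auto
  qed
  ultimately have "finite (range (\<lambda>n. (T ^^ n) x))"
    using finite_surj by blast
  with assms(4) show ?thesis
    by (simp add: Preper_def)
qed

end

theorem theorem1p2:
  fixes \<beta> \<alpha> :: real and s :: sign
  assumes "\<beta> \<in> {1<..<2}"
    and "\<alpha> \<in> rat_adjoin \<beta> \<inter> {0<..<2 - \<beta>}"
  shows "(\<rat> \<inter> J_int \<beta> \<alpha> \<subseteq> Preper s \<beta> \<alpha> \<longrightarrow> pisot_number \<beta> \<or> salem_number \<beta>) \<and>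
    (pisot_number \<beta> \<longrightarrow> Preper s \<beta> \<alpha> = rat_adjoin \<beta> \<inter> J_int \<beta> \<alpha>)"
proof (intro conjI impI)
  interpret intermediate_beta_map \<beta> \<alpha> s
    using assms by unfold_locales auto
  show "pisot_number \<beta> \<or> salem_number \<beta>" if "\<rat> \<inter> J_int \<beta> \<alpha> \<subseteq> Preper s \<beta> \<alpha>"
  \<comment> \<open>All other conjugates have modulus at most 1, so a conjugate on the unit circle
    decides between Salem and Pisot.\<close>
  proof (cases "\<exists>z. galois_conjugate \<beta> z \<and> z \<noteq> complex_of_real \<beta> \<and> norm z = 1")
    case True
    then show ?thesis
      unfolding salem_number_def
      using algebraic_int_base[OF that] galois_conjugate_norm_le_1[OF that] \<beta>_gt_1 by blast
  next
    case False
    then have "norm z < 1" if "galois_conjugate \<beta> z" "z \<noteq> complex_of_real \<beta>" for z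
      using galois_conjugate_norm_le_1[OF \<open>_ \<subseteq> Preper s \<beta> \<alpha>\<close> that] that by (auto simp: order_le_less)
    then show ?thesis
      unfolding pisot_number_def using algebraic_int_base[OF that] \<beta>_gt_1 by blast
  qed
  show "Preper s \<beta> \<alpha> = rat_adjoin \<beta> \<inter> J_int \<beta> \<alpha>" if "pisot_number \<beta>"
    using Preper_subset_rat_adjoin rat_adjoin_subset_Preper[OF that] assms(2)
    by (auto simp: Preper_def)
qed

end
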